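(* Let $X$ be a Banach space. Suppose there exist $\delta>0$ and $z^*\in S_{X^*}$ such that $X$ denies the Daugavet property with the set $S(B_X,z^*,\delta)\cap S_X$. Then $X$ is not a Daugavet domain.
   Context: All Banach spaces are real and different from $\{0\}$. A nonzero continuous linear operator $G:X\to Y$ between Banach spaces is a Daugavet center if every (bounded) rank-1 operator $T:X\to Y$ satisfies $\|G+T\|=\|G\|+\|T\|$. A Banach space $X$ is a Daugavet domain if there exist a Banach space $Y$ and a Daugavet center $G:X\to Y$. $B_X$ and $S_X$ are the closed unit ball and unit sphere of $X$. For $z^*\in S_{X^*}$ and $\varepsilon>0$, $S(B_X,z^*,\varepsilon)=\{x\in B_X: z^*(x)>1-\varepsilon\}$. For $x^*\in X^*$, $y\in X$, $x^*\otimes y$ is the operator $x\mapsto x^*(x)y$. $X$ denies the Daugavet property with a set $A\subset S_X$ if there is an $\varepsilon>0$ such that for every $y\in A$ there exists an $x^*\in S_{X^*}$ satisfying $\|\mathrm{Id}+x^*\otimes y\|<2-\varepsilon$. *)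

theory Defs
  imports "HOL-Analysis.Analysis"
begin

text \<open>
  A Banach space is a type of class \<^class>\<open>banach\<close>. Nontriviality is not imposed separately: a functional
  of norm one forces its domain to be nonzero, and a nonzero operator forces both its spaces to be.
  The dual of \<open>'a\<close> is \<open>'a \<Rightarrow>\<^sub>L real\<close> with the operator norm.
\<close>

lift_definition tensor ::
  "('a::real_normed_vector \<Rightarrow>\<^sub>L real) \<Rightarrow> 'b::real_normed_vector \<Rightarrow> ('a \<Rightarrow>\<^sub>L 'b)"
  is "\<lambda>f y x. f x *\<^sub>R y"
  by (rule bounded_linear_scaleR_const)

definition rank_one :: "('a::real_normed_vector \<Rightarrow>\<^sub>L 'b::real_normed_vector) \<Rightarrow> bool" where
  "rank_one T \<longleftrightarrow> dim (range (blinfun_apply T)) = 1"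

definition daugavet_center :: "('a::banach \<Rightarrow>\<^sub>L 'b::banach) \<Rightarrow> bool" where
  "daugavet_center G \<longleftrightarrow>
     G \<noteq> 0 \<and> (\<forall>T :: 'a \<Rightarrow>\<^sub>L 'b. rank_one T \<longrightarrow> norm (G + T) = norm G + norm T)"

text \<open>
  HOL cannot quantify over types inside a formula, so the codomain is a parameter of the following
  predicate: \<open>'a\<close> is a Daugavet domain iff \<open>daugavet_domain_into TYPE('a) TYPE('b)\<close> holds for some
  Banach space \<open>'b\<close>. Hence \<open>'a\<close> is not a Daugavet domain iff the negation holds for every \<open>'b\<close>,
  which a free type variable \<open>'b\<close> in a theorem expresses.
\<close>

definition daugavet_domain_into :: "'a::banach itself \<Rightarrow> 'b::banach itself \<Rightarrow> bool" where
  "daugavet_domain_into _ _ \<longleftrightarrow> (\<exists>G :: 'a \<Rightarrow>\<^sub>L 'b. daugavet_center G)"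

definition slice :: "'a::real_normed_vector set \<Rightarrow> ('a \<Rightarrow>\<^sub>L real) \<Rightarrow> real \<Rightarrow> 'a set" where
  "slice B f e = {x \<in> B. blinfun_apply f x > 1 - e}"

definition denies_daugavet_with :: "'a::banach set \<Rightarrow> bool" where
  "denies_daugavet_with A \<longleftrightarrow>
     A \<subseteq> sphere 0 1 \<and>
     (\<exists>e>0. \<forall>y\<in>A. \<exists>f :: 'a \<Rightarrow>\<^sub>L real.
        f \<in> sphere 0 1 \<and> norm (id_blinfun + tensor f y) < 2 - e)"

end

theory Submission
  imports Defs
begin

text \<open>
  Let \<open>G\<close> be a Daugavet center. Testing it against \<open>z \<otimes> v\<close> with \<open>\<parallel>v\<parallel> = \<parallel>G\<parallel>\<close> gives a unit vector
  \<open>y\<close> in the slice of \<open>z\<close> at which \<open>G\<close> almost attains its norm. For the functional \<open>f\<close> that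
  denies the Daugavet property at \<open>y\<close>, we have \<open>G + f \<otimes> G y = G \<circ> (Id + f \<otimes> y)\<close>. The norm of the
  left side is \<open>\<parallel>G\<parallel> + \<parallel>G y\<parallel>\<close>, close to \<open>2 \<parallel>G\<parallel>\<close>, while the right side has norm at most
  \<open>(2 - \<epsilon>) \<parallel>G\<parallel>\<close>.
\<close>

lemma tensor_apply [simp]: "blinfun_apply (tensor f y) x = blinfun_apply f x *\<^sub>R y"
  by transfer simp

lemma norm_tensor: "norm (tensor f y) = norm f * norm y"
  by transfer (rule onorm_scaleR_left)

lemma rank_one_tensor:
  assumes "f \<noteq> 0" and "y \<noteq> 0"
  shows "rank_one (tensor f y)"
proof -
  obtain a where a: "blinfun_apply f a \<noteq> 0"
    using assms(1) by (metis blinfun_eqI zero_blinfun.rep_eq)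
  have "k *\<^sub>R y \<in> range (blinfun_apply (tensor f y))" for k
    by (rule range_eqI[of _ _ "(k / blinfun_apply f a) *\<^sub>R a"]) (use a in \<open>simp add: blinfun.scaleR_right\<close>)
  then have "range (blinfun_apply (tensor f y)) = span {y}"
    by (auto simp: span_singleton)
  then show ?thesis
    using assms(2) dim_span[of "{y}"] by (simp add: rank_one_def dim_eq_card_independent)
qed

text \<open>Covering \<open>f = 0\<close> and \<open>y = 0\<close>, where the tensor vanishes and so
  is not of rank one, spares each use a proof that both factors are nonzero.\<close>

lemma daugavet_center_norm_tensor:
  assumes "daugavet_center G"
  shows "norm (G + tensor f y) = norm G + norm f * norm y"
proof (cases "f = 0 \<or> y = 0")
  case True
  then have "tensor f y = 0" by (auto intro: blinfun_eqI)
  then show ?thesis using True by auto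
next
  case False
  then show ?thesis
    using assms rank_one_tensor[of f y] by (simp add: daugavet_center_def norm_tensor)
qed

text \<open>If no vector violated the bound \<open>c\<close>, the operator norm would be at most
  \<open>c\<close>; a violating vector is nonzero and can be normalized.\<close>

lemma blinfun_unit_vector_norm_gt:
  fixes T :: "'a::real_normed_vector \<Rightarrow>\<^sub>L 'b::real_normed_vector"
  assumes "0 \<le> c" and "c < norm T"
  obtains x where "norm x = 1" and "c < norm (blinfun_apply T x)"
proof -
  obtain x where x: "c * norm x < norm (blinfun_apply T x)"
    using norm_blinfun_bound[OF assms(1), of T] assms(2) by (meson not_le)
  then have "x \<noteq> 0" by auto
  with x show thesis
    by (intro that[of "x /\<^sub>R norm x"]) (simp_all add: blinfun.scaleR_right field_simps)
qed

lemma daugavet_center_almost_attains_norm_on_slice: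
  fixes G :: "'a::banach \<Rightarrow>\<^sub>L 'b::banach"
  assumes "daugavet_center G" and "norm z = 1" and "\<eta> > 0"
  obtains y where "norm y = 1" and "blinfun_apply z y > 1 - \<eta>"
    and "norm (blinfun_apply G y) > norm G * (1 - \<eta>)"
proof -
  \<comment> \<open>Capping at 1 keeps the lower bound \<open>norm G * (2 - t)\<close> nonnegative
    even for large \<open>\<eta>\<close>.\<close>
  define t where "t = min \<eta> 1"
  have t: "0 < t" "t \<le> 1" "t \<le> \<eta>" using assms(3) by (auto simp: t_def)
  have "G \<noteq> 0" using assms(1) by (simp add: daugavet_center_def)
  then have g: "norm G > 0" by simp
  obtain w where w: "blinfun_apply G w \<noteq> 0"
    using \<open>G \<noteq> 0\<close> by (metis blinfun_eqI zero_blinfun.rep_eq)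
  \<comment> \<open>Only the norm of \<open>v\<close> matters; the nonzero value \<open>G w\<close>
    supplies a direction in the codomain.\<close>
  define v where "v = (norm G / norm (blinfun_apply G w)) *\<^sub>R blinfun_apply G w"
  have v: "norm v = norm G" using w by (simp add: v_def)
  have "norm G * (2 - t) < norm (G + tensor z v)"
    using g t v assms(2) daugavet_center_norm_tensor[OF assms(1), of z v]
    by (simp add: algebra_simps)
  moreover have "0 \<le> norm G * (2 - t)" using t by simp
  ultimately obtain x where x: "norm x = 1"
    and gt: "norm G * (2 - t) < norm (blinfun_apply (G + tensor z v) x)"
    by (metis blinfun_unit_vector_norm_gt)
  have "norm (blinfun_apply (G + tensor z v) x)
      \<le> norm (blinfun_apply G x) + \<bar>blinfun_apply z x\<bar> * norm G"
    using norm_triangle_ineq[of "blinfun_apply G x" "blinfun_apply z x *\<^sub>R v"] v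
    by (simp add: blinfun.add_left)
  with gt have sum: "norm G * (2 - t) < norm (blinfun_apply G x) + \<bar>blinfun_apply z x\<bar> * norm G"
    by simp
  \<comment> \<open>Each of the two summands is at most \<open>norm G\<close>, so a sum near twice
    that forces both to be near it.\<close>
  have "norm (blinfun_apply G x) \<le> norm G" "\<bar>blinfun_apply z x\<bar> \<le> 1"
    using norm_blinfun[of G x] norm_blinfun[of z x] x assms(2) by simp_all
  moreover from this have "norm G * \<bar>blinfun_apply z x\<bar> \<le> norm G"
    by (intro mult_left_le) auto
  ultimately have "norm G * (1 - t) < norm G * \<bar>blinfun_apply z x\<bar>"
    and "norm G * (1 - t) < norm (blinfun_apply G x)"
    using sum by (simp_all add: algebra_simps)
  moreover have "norm G * (1 - \<eta>) \<le> norm G * (1 - t)"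
    using t g by (intro mult_left_mono) auto
  ultimately have Gx: "norm G * (1 - \<eta>) < norm (blinfun_apply G x)"
    and "norm G * (1 - \<eta>) < norm G * \<bar>blinfun_apply z x\<bar>"
    by linarith+
  then have zx: "1 - \<eta> < \<bar>blinfun_apply z x\<bar>"
    using g by simp
  \<comment> \<open>Only the absolute value of \<open>z x\<close> is controlled; passing to
    \<open>- x\<close> fixes the sign and keeps both norms.\<close>
  show thesis
  proof (cases "blinfun_apply z x \<ge> 0")
    case True
    then show thesis using that[of x] x zx Gx by simp
  next
    case False
    then show thesis using that[of "- x"] x zx Gx by (simp add: blinfun.minus_right)
  qed
qed

theorem lemma2p5:
  fixes \<delta> :: real and z :: "'a::banach \<Rightarrow>\<^sub>L real"
  assumes "\<delta> > 0" and "z \<in> sphere 0 1"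
    and "denies_daugavet_with (slice (cball 0 1) z \<delta> \<inter> sphere 0 1)"
  shows "\<not> daugavet_domain_into TYPE('a) TYPE('b::banach)"
proof
  assume "daugavet_domain_into TYPE('a) TYPE('b)"
  then obtain G :: "'a \<Rightarrow>\<^sub>L 'b" where G: "daugavet_center G"
    by (auto simp: daugavet_domain_into_def)
  then have g: "norm G > 0" by (simp add: daugavet_center_def)
  obtain e where e: "e > 0"
    and deny: "\<And>y. y \<in> slice (cball 0 1) z \<delta> \<inter> sphere 0 1 \<Longrightarrow>
      \<exists>f :: 'a \<Rightarrow>\<^sub>L real. f \<in> sphere 0 1 \<and> norm (id_blinfun + tensor f y) < 2 - e"
    using assms(3) by (auto simp: denies_daugavet_with_def)
  \<comment> \<open>The bound \<open>\<delta>\<close> puts \<open>y\<close> in the slice; the bound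
    \<open>e\<close> makes \<open>G y\<close> long enough to contradict the denial.\<close>
  obtain y where y: "norm y = 1" "blinfun_apply z y > 1 - min \<delta> e"
      "norm (blinfun_apply G y) > norm G * (1 - min \<delta> e)"
    using daugavet_center_almost_attains_norm_on_slice[OF G, of z "min \<delta> e"] assms(1,2) e by auto
  then have "y \<in> slice (cball 0 1) z \<delta> \<inter> sphere 0 1"
    by (auto simp: slice_def)
  from deny[OF this] obtain f :: "'a \<Rightarrow>\<^sub>L real"
    where f: "norm f = 1" "norm (id_blinfun + tensor f y) < 2 - e"
    by auto
  have "G + tensor f (blinfun_apply G y) = G o\<^sub>L (id_blinfun + tensor f y)"
    by (rule blinfun_eqI) (simp add: blinfun.add_left blinfun.add_right blinfun.scaleR_right)
  then have "norm G + norm (blinfun_apply G y) \<le> norm G * norm (id_blinfun + tensor f y)"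
    using daugavet_center_norm_tensor[OF G, of f "blinfun_apply G y"] f(1)
      norm_blinfun_compose[of G "id_blinfun + tensor f y"] by simp
  also have "\<dots> < norm G * (2 - e)" using f(2) g by simp
  finally have "norm (blinfun_apply G y) < norm G * (1 - e)" by (simp add: algebra_simps)
  also have "\<dots> \<le> norm G * (1 - min \<delta> e)" using g by simp
  finally show False using y(3) by simp
qed

end
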